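(* Assume that two systems $\dot x=f_a(x)$ and $\dot x=f_b(x)$ are weakly contracting under the same metric transformation $\Theta$. Let $\alpha,\beta$ be non-negative constants with $\alpha+\beta>0$, and assume that the combined system $$\dot x=\alpha f_a(x)+\beta f_b(x)$$ does not leave the set on which the weak contraction condition holds. Then this combined system is also weakly contracting under the metric transformation $\Theta$.
   Context: Systems are autonomous, $\dot x=f(x)$ with state $x\in\mathbb R^n$, $n\ge 2$, and Jacobian $J(x)=\partial f/\partial x$. They are considered on a compact, simply-connected, strictly forward-invariant set $\mathcal X\subset\mathbb R^n$ (any solution starting on the boundary of $\mathcal X$ at $t=0$ remains in the interior of $\mathcal X$ afterwards). For a symmetric (or Hermitian) $n\times n$ matrix $H$, let $\lambda_1(H)\ge\dots\ge\lambda_n(H)$ be its eigenvalues in non-increasing order and let $S_2(H)=\lambda_1(H)+\lambda_2(H)$. A metric transformation is a differentiable field of $n\times n$ matrices $\Theta=\Theta(x,t)$, real or complex, such that the Riemannian metric $\Theta^{*T}\Theta$ (conjugate transpose; $\Theta^T\Theta$ in the real case) is uniformly positive definite. A constant nonsingular matrix $\Theta$ is a special case. The generalized Jacobian of the system $\dot x=f(x)$ associated with $\Theta$ is $$F=\Theta J\Theta^{-1}+\dot\Theta\,\Theta^{-1},$$ where $\dot\Theta$ is the time derivative of $\Theta(x,t)$ along trajectories of the system (so $\dot\Theta=0$ if $\Theta$ is constant). The system is called weakly contracting under $\Theta$ if $S_2(F_H)<0$ for all $x$ in the set considered (and all $t$, when $\Theta$ depends on $t$), where $F_H=\tfrac12(F+F^{*T})$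 is the Hermitian part of $F$ (the symmetric part in the real case).
   Formalization: Added assumption: the metric transformation Θ does not depend explicitly on time on the set considered, or α+β=1. Without it the claim fails, e.g. f_a=f_b=-x on the unit ball, Θ=(2+sin t)I, α=β=1/4. *)

theory Defs
  imports "HOL-Analysis.Analysis" "HOL-Computational_Algebra.Computational_Algebra"
begin

section \<open>Systems and invariant sets\<close>

definition solution_on :: "(real^'n \<Rightarrow> real^'n) \<Rightarrow> real \<Rightarrow> (real \<Rightarrow> real^'n) \<Rightarrow> bool" where
  "solution_on f T \<xi> \<longleftrightarrow>
     (\<forall>t\<in>{0..T}. (\<xi> has_vector_derivative f (\<xi> t)) (at t within {0..T}))"

definition forward_invariant :: "(real^'n) set \<Rightarrow> (real^'n \<Rightarrow> real^'n) \<Rightarrow> bool" where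
  "forward_invariant X f \<longleftrightarrow>
     (\<forall>T \<xi>. solution_on f T \<xi> \<longrightarrow> \<xi> 0 \<in> X \<longrightarrow> (\<forall>t\<in>{0..T}. \<xi> t \<in> X))"

definition strictly_forward_invariant :: "(real^'n) set \<Rightarrow> (real^'n \<Rightarrow> real^'n) \<Rightarrow> bool" where
  "strictly_forward_invariant X f \<longleftrightarrow>
     (\<forall>T \<xi>. solution_on f T \<xi> \<longrightarrow> \<xi> 0 \<in> frontier X \<longrightarrow> (\<forall>t\<in>{0<..T}. \<xi> t \<in> interior X))"


section \<open>Hermitian matrices and their two largest eigenvalues\<close>

definition conj_transpose :: "complex^'n^'m \<Rightarrow> complex^'m^'n" where
  "conj_transpose A = (\<chi> i j. cnj (A $ j $ i))"

definition hermitian_part :: "complex^'n^'n \<Rightarrow> complex^'n^'n" where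
  "hermitian_part A = (1/2) *\<^sub>R (A + conj_transpose A)"

definition charpoly :: "complex^'n^'n \<Rightarrow> complex poly" where
  "charpoly A = det (mat [:0, 1:] - map_matrix (\<lambda>c. [:c:]) A)"

text \<open>
  The eigenvalues, with multiplicity, in non-increasing order. Only meant for Hermitian
  matrices, whose eigenvalues are real, so that applying \<^const>\<open>Re\<close> loses nothing.
\<close>
definition eigenvalues_desc :: "complex^'n^'n \<Rightarrow> real list" where
  "eigenvalues_desc H = rev (sorted_list_of_multiset (image_mset Re (proots (charpoly H))))"

text \<open>List indices start at 0, so this is the sum of the two largest eigenvalues.\<close>
definition S2 :: "complex^'n^'n \<Rightarrow> real" where
  "S2 H = eigenvalues_desc H ! 0 + eigenvalues_desc H ! 1"


section \<open>Metric transformations and weak contraction\<close>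

text \<open>
  Fields of matrices are complex throughout, on pairs (state, time). Real fields are those
  with real entries; for them the conjugate transpose is the transpose and the Hermitian part
  is the symmetric part.
\<close>

definition uniformly_pos_def :: "(real^'n) set \<Rightarrow> ((real^'n) \<times> real \<Rightarrow> complex^'n^'n) \<Rightarrow> bool" where
  "uniformly_pos_def X M \<longleftrightarrow>
     (\<exists>c>0. \<forall>x\<in>X. \<forall>t v. Re (\<Sum>i\<in>UNIV. cnj (v $ i) * (M (x, t) *v v) $ i) \<ge> c * (norm v)\<^sup>2)"

definition metric_transformation :: "(real^'n) set \<Rightarrow> ((real^'n) \<times> real \<Rightarrow> complex^'n^'n) \<Rightarrow> bool" where
  "metric_transformation X \<Theta> \<longleftrightarrow>
     (\<forall>x\<in>X. \<forall>t. \<Theta> differentiable (at (x, t))) \<and>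
     uniformly_pos_def X (\<lambda>p. conj_transpose (\<Theta> p) ** \<Theta> p)"

text \<open>
  The derivative of \<open>\<Theta>(x(t), t)\<close> along trajectories of \<open>x' = f(x)\<close>: the derivative of \<open>\<Theta>\<close>
  in the space-time direction \<open>(f x, 1)\<close>; see the lemma below.
\<close>
definition trajectory_deriv ::
    "((real^'n) \<times> real \<Rightarrow> complex^'n^'n) \<Rightarrow> (real^'n \<Rightarrow> real^'n) \<Rightarrow> real^'n \<Rightarrow> real \<Rightarrow> complex^'n^'n" where
  "trajectory_deriv \<Theta> f x t = frechet_derivative \<Theta> (at (x, t)) (f x, 1)"

lemma trajectory_deriv_along_trajectory:
  assumes "\<Theta> differentiable (at (\<xi> t, t))"
    and "(\<xi> has_vector_derivative f (\<xi> t)) (at t within S)"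
  shows "((\<lambda>s. \<Theta> (\<xi> s, s)) has_vector_derivative trajectory_deriv \<Theta> f (\<xi> t) t) (at t within S)"
proof -
  have d: "(\<Theta> has_derivative frechet_derivative \<Theta> (at (\<xi> t, t))) (at (\<xi> t, t))"
    using assms(1) by (simp add: frechet_derivative_works)
  have p: "((\<lambda>s. (\<xi> s, s)) has_vector_derivative (f (\<xi> t), 1)) (at t within S)"
    using assms(2) by (intro has_vector_derivative_Pair derivative_intros)
  have "((\<Theta> \<circ> (\<lambda>s. (\<xi> s, s))) has_derivative
      (frechet_derivative \<Theta> (at (\<xi> t, t)) \<circ> (\<lambda>h. h *\<^sub>R (f (\<xi> t), 1)))) (at t within S)"
    using d p unfolding has_vector_derivative_def
    by (intro diff_chain_within) (auto intro: has_derivative_at_withinI)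
  moreover have "linear (frechet_derivative \<Theta> (at (\<xi> t, t)))"
    using assms(1) by (rule linear_frechet_derivative)
  ultimately show ?thesis
    unfolding has_vector_derivative_def trajectory_deriv_def o_def
    by (simp add: linear_scale del: scaleR_Pair)
qed

definition generalized_jacobian ::
    "((real^'n) \<times> real \<Rightarrow> complex^'n^'n) \<Rightarrow> (real^'n \<Rightarrow> real^'n) \<Rightarrow> real^'n \<Rightarrow> real \<Rightarrow> complex^'n^'n" where
  "generalized_jacobian \<Theta> f x t =
     \<Theta> (x, t) ** map_matrix complex_of_real (jacobian f (at x)) ** matrix_inv (\<Theta> (x, t))
     + trajectory_deriv \<Theta> f x t ** matrix_inv (\<Theta> (x, t))"

definition weakly_contracting ::
    "(real^'n) set \<Rightarrow> ((real^'n) \<times> real \<Rightarrow> complex^'n^'n) \<Rightarrow> (real^'n \<Rightarrow> real^'n) \<Rightarrow> bool" where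
  "weakly_contracting X \<Theta> f \<longleftrightarrow>
     (\<forall>x\<in>X. \<forall>t. S2 (hermitian_part (generalized_jacobian \<Theta> f x t)) < 0)"

end

theory Submission
  imports Defs
begin

text \<open>
  Two facts carry the proof. The first is that the generalized Jacobian depends linearly on the
  vector field: \<open>F = \<alpha> F\<^sub>a + \<beta> F\<^sub>b\<close> for the combined system (lemma
  \<open>generalized_jacobian_combination\<close>). The terms \<open>\<Theta> J \<Theta>\<^sup>-\<^sup>1\<close> are linear because differentiation is.
  The derivative of \<open>\<Theta>\<close> along trajectories is its derivative in the space-time direction
  \<open>(f x, 1)\<close>, which is only affine in \<open>f\<close>; the resulting error in the combination is \<open>1 - (\<alpha> + \<beta>)\<close>
  times the explicit time derivative of \<open>\<Theta>\<close>, and it vanishes when \<open>\<Theta>\<close> is constant in time or the combination is convex.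
  Taking Hermitian parts preserves the relation.

  The second is that \<open>S\<^sub>2\<close> is sublinear on Hermitian matrices (lemma \<open>S2_sublinear\<close>), so that
  \<open>S\<^sub>2(\<alpha> A + \<beta> B) \<le> \<alpha> S\<^sub>2(A) + \<beta> S\<^sub>2(B)\<close> for the Hermitian parts \<open>A, B\<close> of \<open>F\<^sub>a, F\<^sub>b\<close>. The right side is
  negative because \<open>S\<^sub>2(A)\<close> and \<open>S\<^sub>2(B)\<close> are and one of the nonnegative coefficients is positive.
  This follows from Ky Fan's principle: \<open>S\<^sub>2(H)\<close> is the maximum of \<open>\<langle>u, H u\<rangle> + \<langle>v, H v\<rangle>\<close> over
  orthonormal pairs \<open>u, v\<close> (lemmas \<open>orthonormal_pair_le_S2\<close> and \<open>S2_attained\<close>), and a maximum of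
  functions that are linear in \<open>H\<close> is sublinear.

  Ky Fan's principle in turn rests on an orthonormal eigenbasis
  (lemma \<open>hermitian_orthonormal_eigenbasis\<close>) and on its eigenvalues being exactly the roots, with
  multiplicity, of the characteristic polynomial (lemma \<open>charpoly_eigenbasis\<close>).
\<close>

section \<open>The Hermitian inner product\<close>

definition cinner :: "complex^'n \<Rightarrow> complex^'n \<Rightarrow> complex" where
  "cinner u v = (\<Sum>i\<in>UNIV. cnj (u $ i) * v $ i)"

lemma cinner_add_right: "cinner w (u + v) = cinner w u + cinner w v"
  and cinner_diff_right: "cinner w (u - v) = cinner w u - cinner w v"
  by (simp_all add: cinner_def algebra_simps sum.distrib sum_subtractf)

lemma cinner_scale_right: "cinner u (c *s v) = c * cinner u v"
  by (simp add: cinner_def sum_distrib_left algebra_simps)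

lemma cinner_scale_left: "cinner (c *s u) v = cnj c * cinner u v"
  by (simp add: cinner_def sum_distrib_left algebra_simps)

lemma cinner_zero_right [simp]: "cinner u 0 = 0"
  by (simp add: cinner_def)

lemma cinner_sum_right: "cinner u (\<Sum>x\<in>S. f x) = (\<Sum>x\<in>S. cinner u (f x))"
  by (induction S rule: infinite_finite_induct) (auto simp: cinner_add_right)

lemma cinner_cnj: "cnj (cinner u v) = cinner v u"
  by (simp add: cinner_def mult.commute)

text \<open>
  The real inner product of the Euclidean space \<open>\<complex>\<^sup>n\<close> is the real part of the Hermitian one. Compactness
  arguments and norms use the former, complex orthogonality the latter.
\<close>
lemma Re_cinner: "Re (cinner u v) = u \<bullet> v"
  by (simp add: cinner_def inner_vec_def inner_complex_def)

lemma cinner_self: "cinner u u = complex_of_real ((norm u)\<^sup>2)"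
proof (rule complex_eqI)
  show "Re (cinner u u) = Re (complex_of_real ((norm u)\<^sup>2))"
    by (simp add: Re_cinner power2_norm_eq_inner)
  show "Im (cinner u u) = Im (complex_of_real ((norm u)\<^sup>2))"
    using cinner_cnj[of u u] by (metis Im_complex_of_real Reals_cnj_iff complex_is_Real_iff)
qed

lemma cinner_matrix_adjoint: "cinner (A *v u) v = cinner u (conj_transpose A *v v)"
proof -
  have "cinner (A *v u) v = (\<Sum>i\<in>UNIV. \<Sum>j\<in>UNIV. cnj (A $ i $ j) * cnj (u $ j) * v $ i)"
    by (simp add: cinner_def matrix_vector_mult_def sum_distrib_right)
  also have "\<dots> = (\<Sum>j\<in>UNIV. \<Sum>i\<in>UNIV. cnj (A $ i $ j) * cnj (u $ j) * v $ i)"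
    by (rule sum.swap)
  also have "\<dots> = cinner u (conj_transpose A *v v)"
    by (simp add: cinner_def matrix_vector_mult_def conj_transpose_def sum_distrib_left mult_ac)
  finally show ?thesis .
qed

lemma scaleR_eq_scale: "r *\<^sub>R v = complex_of_real r *s v"
  by (simp add: vec_eq_iff scaleR_conv_of_real[where 'a = complex])


section \<open>Orthonormal sets\<close>

definition orthonormal :: "(complex^'n) set \<Rightarrow> bool" where
  "orthonormal S \<longleftrightarrow> (\<forall>u\<in>S. \<forall>v\<in>S. cinner u v = (if u = v then 1 else 0))"

lemma orthonormal_norm:
  assumes "orthonormal S" "u \<in> S"
  shows "norm u = 1"
proof -
  have "complex_of_real ((norm u)\<^sup>2) = 1"
    using assms cinner_self[of u] by (simp add: orthonormal_def)
  then have "(norm u)\<^sup>2 = 1"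
    by (simp only: of_real_eq_1_iff)
  then show ?thesis
    using norm_ge_zero[of u] by (auto simp: power2_eq_1_iff)
qed

text \<open>
  Pairing a vanishing combination with one member of the set isolates that member's coefficient.
\<close>
lemma orthonormal_independent:
  assumes "orthonormal S"
  shows "vec.independent S"
  unfolding vec.independent_explicit_finite_subsets
proof (intro allI impI ballI)
  fix T c u
  assume T: "T \<subseteq> S" "finite T" and 0: "(\<Sum>v\<in>T. c v *s v) = 0" and u: "u \<in> T"
  have "0 = cinner u (\<Sum>v\<in>T. c v *s v)"
    using 0 by simp
  also have "\<dots> = (\<Sum>v\<in>T. if v = u then c v else 0)"
    unfolding cinner_sum_right cinner_scale_right
    using assms T u by (intro sum.cong) (auto simp: orthonormal_def subset_iff)
  finally show "c u = 0"
    using T u by simp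
qed

lemma
  fixes S :: "(complex^'n) set"
  assumes "orthonormal S"
  shows orthonormal_finite: "finite S" and orthonormal_card_le: "card S \<le> CARD('n)"
  using orthonormal_independent[OF assms] vec.finiteI_independent vec.independent_card_le_dim[of S UNIV]
  by (auto simp: vec.dim_UNIV card_cart_basis)

text \<open>
  For orthonormal \<open>S\<close>, what remains of \<open>x\<close> after subtracting its orthogonal projection to the
  span of \<open>S\<close>.
\<close>
definition orthogonal_residual :: "(complex^'n) set \<Rightarrow> complex^'n \<Rightarrow> complex^'n" where
  "orthogonal_residual S x = x - (\<Sum>u\<in>S. cinner u x *s u)"

lemma cinner_projection:
  assumes "orthonormal S" "u \<in> S"
  shows "cinner u (\<Sum>v\<in>S. c v *s v) = c u"
proof -
  have "cinner u (\<Sum>v\<in>S. c v *s v) = (\<Sum>v\<in>S. if v = u then c v else 0)"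
    unfolding cinner_sum_right cinner_scale_right
    using assms by (intro sum.cong) (auto simp: orthonormal_def)
  then show ?thesis
    using assms(2) orthonormal_finite[OF assms(1)] by simp
qed

lemma orthogonal_residual_orthogonal:
  "orthonormal S \<Longrightarrow> u \<in> S \<Longrightarrow> cinner u (orthogonal_residual S x) = 0"
  by (simp add: orthogonal_residual_def cinner_diff_right cinner_projection)

text \<open>
  The residual and the projection of \<open>x\<close> are orthogonal, so by Pythagoras the projection, whose
  squared length is the sum on the left, is no longer than \<open>x\<close>.
\<close>
lemma bessel_inequality:
  assumes "orthonormal S"
  shows "(\<Sum>u\<in>S. (cmod (cinner u x))\<^sup>2) \<le> (norm x)\<^sup>2"
proof -
  define z where "z = orthogonal_residual S x"
  define p where "p = (\<Sum>u\<in>S. cinner u x *s u)"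
  have pyth: "cinner y p = (\<Sum>u\<in>S. cinner u x * cinner y u)" for y
    by (simp add: p_def cinner_sum_right cinner_scale_right)
  have "cinner z p = 0"
    unfolding pyth
    using orthogonal_residual_orthogonal[OF assms, of _ x] cinner_cnj
    by (metis (no_types, lifting) z_def complex_cnj_zero mult_zero_right sum.neutral)
  then have "z \<bullet> p = 0"
    by (metis Re_cinner zero_complex.sel(1))
  moreover have "x = z + p"
    by (simp add: z_def p_def orthogonal_residual_def)
  ultimately have "(norm x)\<^sup>2 = (norm z)\<^sup>2 + (norm p)\<^sup>2"
    by (simp add: power2_norm_eq_inner inner_simps inner_commute)
  moreover have "cinner p p = (\<Sum>u\<in>S. complex_of_real ((cmod (cinner u x))\<^sup>2))"
    unfolding pyth[of p]
  proof (rule sum.cong)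
    fix u assume "u \<in> S"
    then have "cinner u p = cinner u x"
      using assms by (simp add: p_def cinner_projection)
    then have "cinner p u = cnj (cinner u x)"
      by (metis cinner_cnj)
    then show "cinner u x * cinner p u = complex_of_real ((cmod (cinner u x))\<^sup>2)"
      by (simp only: complex_norm_square)
  qed simp
  then have "(norm p)\<^sup>2 = (\<Sum>u\<in>S. (cmod (cinner u x))\<^sup>2)"
    unfolding cinner_self by (metis of_real_sum of_real_eq_iff)
  ultimately show ?thesis
    by simp
qed

lemma orthonormal_insert:
  assumes "orthonormal S" "\<And>u. u \<in> S \<Longrightarrow> cinner u w = 0" "norm w = 1"
  shows "orthonormal (insert w S)" "w \<notin> S"
proof -
  have w: "cinner w w = 1"
    using assms(3) by (simp add: cinner_self)
  then show "w \<notin> S"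
    using assms(2) by force
  moreover have "cinner w u = 0" if "u \<in> S" for u
    using assms(2)[OF that] cinner_cnj[of u w] by simp
  ultimately show "orthonormal (insert w S)"
    using assms w by (auto simp: orthonormal_def)
qed

text \<open>
  A nonzero residual could be normalized and added to \<open>S\<close>, which would give more than \<open>n\<close>
  linearly independent vectors.
\<close>
lemma orthonormal_basis_expansion:
  fixes S :: "(complex^'n) set"
  assumes S: "orthonormal S" and card: "card S = CARD('n)"
  shows "x = (\<Sum>u\<in>S. cinner u x *s u)"
proof (rule ccontr)
  let ?z = "orthogonal_residual S x"
  assume "x \<noteq> (\<Sum>u\<in>S. cinner u x *s u)"
  then have z: "?z \<noteq> 0"
    by (simp add: orthogonal_residual_def)
  let ?w = "(1 / norm ?z) *\<^sub>R ?z"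
  have "cinner u ?w = 0" if "u \<in> S" for u
    using orthogonal_residual_orthogonal[OF S that] by (simp add: scaleR_eq_scale cinner_scale_right)
  moreover have "norm ?w = 1"
    using z by simp
  ultimately have "orthonormal (insert ?w S)" "?w \<notin> S"
    using orthonormal_insert[OF S] by blast+
  then show False
    using orthonormal_card_le[of "insert ?w S"] orthonormal_finite[OF S] card by simp
qed


section \<open>Orthonormal eigenbases of Hermitian matrices\<close>

text \<open>
  A maximizer \<open>u\<close> of the Rayleigh quotient on the unit sphere of \<open>W\<close> is an eigenvector. Moving from
  \<open>u\<close> in the direction of the defect \<open>r = T u - m u\<close>, which lies in \<open>W\<close> by invariance, would increase
  the quotient to first order unless \<open>r = 0\<close>.
\<close>
lemma self_adjoint_eigenvector_in_subspace:
  fixes T :: "'a::euclidean_space \<Rightarrow> 'a"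
  assumes lin: "linear T" and adj: "\<And>x y. T x \<bullet> y = x \<bullet> T y"
    and W: "subspace W" "\<And>w. w \<in> W \<Longrightarrow> T w \<in> W" and w0: "w0 \<in> W" "w0 \<noteq> 0"
  obtains m u where "u \<in> W" "norm u = 1" "T u = m *\<^sub>R u"
proof -
  let ?K = "W \<inter> sphere 0 1"
  have "compact ?K"
    using W(1) by (simp add: closed_subspace closed_Int_compact)
  moreover have "(1 / norm w0) *\<^sub>R w0 \<in> ?K"
    using w0 W(1) by (simp add: subspace_scale)
  moreover have "continuous_on ?K (\<lambda>w. w \<bullet> T w)"
    using lin by (intro continuous_intros linear_continuous_on) (simp add: linear_conv_bounded_linear)
  ultimately obtain u where u: "u \<in> ?K" and u_max: "\<And>w. w \<in> ?K \<Longrightarrow> w \<bullet> T w \<le> u \<bullet> T u"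
    using continuous_attains_sup[of ?K "\<lambda>w. w \<bullet> T w"] by blast
  define m where "m = u \<bullet> T u"
  have uu: "u \<bullet> u = 1" and uW: "u \<in> W"
    using u by (auto simp: norm_eq_1)
  have rayleigh: "w \<bullet> T w \<le> m * (w \<bullet> w)" if "w \<in> W" for w
  proof (cases "w = 0")
    case False
    have "(1 / norm w) *\<^sub>R w \<in> ?K"
      using that W(1) False by (simp add: subspace_scale)
    from u_max[OF this] have "(w \<bullet> T w) / (norm w)\<^sup>2 \<le> m"
      by (simp add: linear_scale[OF lin] m_def power2_eq_square divide_divide_eq_left)
    then show ?thesis
      using False by (simp add: divide_le_eq power2_norm_eq_inner)
  qed simp
  define r where "r = T u - m *\<^sub>R u"
  define C where "C = m * (r \<bullet> r) - r \<bullet> T r"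
  have rW: "r \<in> W"
    using W uW by (auto simp: r_def intro: subspace_diff subspace_scale)
  have Tu: "T u = r + m *\<^sub>R u"
    by (simp add: r_def)
  have ru: "r \<bullet> u = 0" "u \<bullet> r = 0"
    using uu by (simp_all add: r_def inner_simps m_def inner_commute)
  have first_order: "2 * e * (r \<bullet> r) \<le> e\<^sup>2 * C" for e
  proof -
    have "u + e *\<^sub>R r \<in> W"
      using W(1) uW rW by (simp add: subspace_add subspace_scale)
    from rayleigh[OF this]
    have "u \<bullet> T u + e * (r \<bullet> T u) + e * (u \<bullet> T r) + e * e * (r \<bullet> T r) \<le> m * (1 + e * e * (r \<bullet> r))"
      using uu ru by (simp add: linear_add[OF lin] linear_scale[OF lin] inner_simps algebra_simps)
    moreover have "u \<bullet> T r = r \<bullet> r" "r \<bullet> T u = r \<bullet> r"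
      using adj[of u r] ru by (simp_all add: Tu inner_simps)
    ultimately show ?thesis
      by (simp add: m_def C_def algebra_simps power2_eq_square)
  qed
  \<comment> \<open>The left side of the first-order inequality is linear in the step, the right side
    quadratic; a step small against \<open>C\<close> separates them.\<close>
  have "r \<bullet> r = 0"
  proof (rule ccontr)
    assume "r \<bullet> r \<noteq> 0"
    then have a: "r \<bullet> r > 0"
      by simp
    let ?e = "(r \<bullet> r) / (1 + \<bar>C\<bar>)"
    have e: "?e > 0"
      using a by (simp add: add_pos_nonneg)
    have "?e * (2 * (r \<bullet> r)) \<le> ?e * (?e * C)"
      using first_order[of ?e] by (simp add: power2_eq_square mult_ac)
    then have "2 * (r \<bullet> r) \<le> ?e * C"
      using e by (simp only: mult_le_cancel_left_pos)
    also have "?e * C \<le> ?e * (1 + \<bar>C\<bar>)"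
      using e by (intro mult_left_mono) auto
    also have "\<dots> = r \<bullet> r"
      by (simp add: add_nonneg_eq_0_iff)
    finally show False
      using a by simp
  qed
  then have "T u = m *\<^sub>R u"
    by (simp add: Tu)
  with uW uu that show thesis
    by (simp add: norm_eq_1)
qed

text \<open>
  An orthonormal set \<open>S\<close> of eigenvectors of maximal size is a basis: otherwise its orthogonal
  complement \<open>W\<close> is nonzero and, as \<open>H\<close> is Hermitian, invariant under \<open>H\<close>, hence contains a further
  unit eigenvector. Viewing \<open>W\<close> as a real subspace and \<open>H\<close> as a real self-adjoint map makes the
  eigenvalues real from the start.
\<close>
lemma hermitian_orthonormal_eigenbasis:
  fixes H :: "complex^'n^'n"
  assumes H: "conj_transpose H = H"
  obtains S m where "orthonormal S" "card S = CARD('n)"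
    "\<And>u. u \<in> S \<Longrightarrow> H *v u = complex_of_real (m u) *s u"
proof -
  define P where "P S \<longleftrightarrow> orthonormal S \<and> (\<forall>u\<in>S. \<exists>m. H *v u = complex_of_real m *s u)" for S
  have "P {}"
    by (simp add: P_def orthonormal_def)
  moreover have "\<forall>S. P S \<longrightarrow> card S < Suc CARD('n)"
    by (auto simp: P_def less_Suc_eq_le intro: orthonormal_card_le)
  ultimately obtain S where S: "P S" and S_max: "\<And>S'. P S' \<Longrightarrow> card S' \<le> card S"
    using ex_has_greatest_nat[of P "{}" card] by blast
  have on: "orthonormal S"
    using S by (simp add: P_def)
  have "card S = CARD('n)"
  proof (rule ccontr)
    assume "card S \<noteq> CARD('n)"
    then have "vec.span S \<noteq> UNIV"
      using vec.dim_eq_card_independent[OF orthonormal_independent[OF on]] vec.dim_span[of S]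
      by (metis vec.dim_UNIV card_cart_basis)
    then obtain x where x: "x \<notin> vec.span S"
      by blast
    define W where "W = {w. \<forall>u\<in>S. cinner u w = 0}"
    have "(\<Sum>u\<in>S. cinner u x *s u) \<in> vec.span S"
      by (intro vec.span_sum vec.span_scale vec.span_base)
    with x have "orthogonal_residual S x \<noteq> 0"
      by (auto simp: orthogonal_residual_def)
    moreover have "orthogonal_residual S x \<in> W"
      by (simp add: W_def orthogonal_residual_orthogonal[OF on])
    moreover have "subspace W"
      by (auto simp: subspace_def W_def cinner_add_right scaleR_eq_scale cinner_scale_right)
    moreover have "H *v w \<in> W" if "w \<in> W" for w
      unfolding W_def
    proof safe
      fix u assume u: "u \<in> S"
      then obtain m where "H *v u = complex_of_real m *s u"
        using S by (auto simp: P_def)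
      then have "cinner u (H *v w) = cnj (complex_of_real m) * cinner u w"
        by (metis H cinner_matrix_adjoint cinner_scale_left)
      then show "cinner u (H *v w) = 0"
        using that u by (simp add: W_def)
    qed
    moreover have "(H *v x) \<bullet> y = x \<bullet> (H *v y)" for x y
      by (metis H Re_cinner cinner_matrix_adjoint)
    moreover have "linear ((*v) H)"
      by (rule linearI) (simp_all add: matrix_vector_right_distrib scaleR_eq_scale vec.scale)
    ultimately obtain m u where u: "u \<in> W" "norm u = 1" "H *v u = m *\<^sub>R u"
      using self_adjoint_eigenvector_in_subspace[of "(*v) H" W "orthogonal_residual S x"] by metis
    then have "orthonormal (insert u S)" "u \<notin> S"
      using orthonormal_insert[OF on] by (auto simp: W_def)
    then have "P (insert u S)"
      using S u(3) by (auto simp: P_def scaleR_eq_scale)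
    from S_max[OF this] show False
      using \<open>u \<notin> S\<close> orthonormal_finite[OF on] by simp
  qed
  moreover obtain m where "\<And>u. u \<in> S \<Longrightarrow> H *v u = complex_of_real (m u) *s u"
    using S unfolding P_def by metis
  ultimately show thesis
    using that on by blast
qed


section \<open>The eigenvalues of a Hermitian matrix\<close>

text \<open>
  The relation \<open>A U = U D\<close> lifts to \<open>(x - A) U = U (x - D)\<close> over the ring of polynomials. Taking
  determinants and cancelling \<open>det U\<close>, which is nonzero because \<open>U\<close> is invertible, leaves the
  characteristic polynomial of a diagonal matrix.
\<close>
lemma charpoly_similar_diagonal:
  fixes A U V :: "complex^'n^'n"
  assumes UV: "U ** V = mat 1" and AU: "A ** U = U ** (\<chi> i j. if i = j then d i else 0)"
  shows "charpoly A = (\<Prod>i\<in>UNIV. [:- d i, 1:])"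
proof -
  let ?P = "map_matrix (\<lambda>c::complex. [:c:])"
  let ?D = "(\<chi> i j. if i = j then d i else 0) :: complex^'n^'n"
  have const_sum: "[:sum f S:] = (\<Sum>x\<in>S. [:f x:])" for f :: "'n \<Rightarrow> complex" and S
  proof (induction S rule: infinite_finite_induct)
    case (insert x F)
    then show ?case
      by (simp flip: insert.IH)
  qed auto
  have P_mult: "?P (X ** Y) = ?P X ** ?P Y" for X Y :: "complex^'n^'n"
    by (simp add: vec_eq_iff matrix_matrix_mult_def const_sum mult.commute)
  have x_comm: "mat [:0, 1:] ** X = X ** mat [:0, 1:]" for X :: "complex poly^'n^'n"
    by (simp add: vec_eq_iff matrix_matrix_mult_def mat_def if_distrib[of "\<lambda>x. x * _"]
        if_distrib[of "\<lambda>x. _ * x"] mult.commute cong: if_cong)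
  have diff_left: "(X - Y) ** Z = X ** Z - Y ** Z" and diff_right: "Z ** (X - Y) = Z ** X - Z ** Y"
    for X Y Z :: "complex poly^'n^'n"
    by (simp_all add: vec_eq_iff matrix_matrix_mult_def left_diff_distrib right_diff_distrib sum_subtractf)
  have "(mat [:0, 1:] - ?P A) ** ?P U = ?P U ** (mat [:0, 1:] - ?P ?D)"
    by (simp only: diff_left diff_right x_comm P_mult[symmetric] AU)
  then have "det ((mat [:0, 1:] - ?P A) ** ?P U) = det (?P U ** (mat [:0, 1:] - ?P ?D))"
    by (rule arg_cong)
  then have "charpoly A * det (?P U) = det (mat [:0, 1:] - ?P ?D) * det (?P U)"
    by (simp only: det_mul charpoly_def mult.commute[of "det (?P U)"])
  moreover have "det (?P U) \<noteq> 0"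
  proof
    assume "det (?P U) = 0"
    then have "det (?P (U ** V)) = 0"
      by (simp add: P_mult det_mul)
    moreover have "?P (mat 1 :: complex^'n^'n) = mat 1"
      by (simp add: vec_eq_iff mat_def one_pCons)
    ultimately show False
      by (simp add: UV)
  qed
  ultimately have "charpoly A = det (mat [:0, 1:] - ?P ?D)"
    by simp
  also have "\<dots> = (\<Prod>i\<in>UNIV. (mat [:0, 1:] - ?P ?D) $ i $ i)"
    by (rule det_diagonal) (simp add: mat_def)
  finally show ?thesis
    by (simp add: mat_def)
qed

text \<open>
  The matrix with the eigenbasis as columns is unitary and diagonalizes \<open>H\<close>. The product counts
  each eigenvalue as often as it occurs in the basis, so it yields the multiplicities that the
  definition of \<^const>\<open>S2\<close> counts.
\<close>
lemma charpoly_eigenbasis: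
  fixes H :: "complex^'n^'n"
  assumes S: "orthonormal S" "card S = CARD('n)"
    and m: "\<And>u. u \<in> S \<Longrightarrow> H *v u = complex_of_real (m u) *s u"
  shows "charpoly H = (\<Prod>u\<in>S. [:- complex_of_real (m u), 1:])"
proof -
  obtain b :: "'n \<Rightarrow> complex^'n" where b: "bij_betw b UNIV S"
    using S finite_same_card_bij[of "UNIV :: 'n set" S] orthonormal_finite by (metis finite)
  let ?U = "(\<chi> i j. b j $ i) :: complex^'n^'n"
  let ?D = "(\<chi> i j. if i = j then complex_of_real (m (b i)) else 0) :: complex^'n^'n"
  have bS: "b j \<in> S" for j
    using b by (auto simp: bij_betw_def)
  have bb: "cinner (b i) (b j) = (if i = j then 1 else 0)" for i j
    using S(1) bS b by (auto simp: orthonormal_def bij_betw_def inj_on_def)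
  have "conj_transpose ?U ** ?U = mat 1"
    using bb by (simp add: vec_eq_iff matrix_matrix_mult_def conj_transpose_def mat_def cinner_def)
  then have U: "?U ** conj_transpose ?U = mat 1"
    by (simp add: matrix_left_right_inverse)
  have "H ** ?U = ?U ** ?D"
  proof -
    have "(H *v b j) $ i = complex_of_real (m (b j)) * b j $ i" for i j
      by (simp add: m[OF bS])
    then show ?thesis
      by (simp add: vec_eq_iff matrix_matrix_mult_def matrix_vector_mult_def
          if_distrib[of "\<lambda>x. _ * x"] mult.commute cong: if_cong)
  qed
  from charpoly_similar_diagonal[OF U this]
  show ?thesis
    by (simp add: prod.reindex_bij_betw[OF b, of "\<lambda>u. [:- complex_of_real (m u), 1:]"])
qed

text \<open>
  Both indices are chosen by maximality, which keeps them distinct even when the two largest values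
  coincide. The upper bounds on the other values are what the estimate in Ky Fan's principle needs.
\<close>
lemma two_largest:
  fixes m :: "'a \<Rightarrow> real"
  assumes S: "finite S" "card S \<ge> 2"
  obtains a b where "a \<in> S" "b \<in> S" "a \<noteq> b" "m b \<le> m a" "\<And>c. c \<in> S - {a} \<Longrightarrow> m c \<le> m b"
    "rev (sorted_list_of_multiset (image_mset m (mset_set S))) ! 0 = m a"
    "rev (sorted_list_of_multiset (image_mset m (mset_set S))) ! 1 = m b"
proof -
  have maximizer: "\<exists>a\<in>T. \<forall>c\<in>T. m c \<le> m a" if "finite T" "T \<noteq> {}" for T
  proof -
    have "Max (m ` T) \<in> m ` T"
      using that by simp
    then obtain a where "a \<in> T" "m a = Max (m ` T)"
      by auto
    moreover have "m c \<le> Max (m ` T)" if "c \<in> T" for c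
      using that \<open>finite T\<close> by simp
    ultimately show ?thesis
      by (intro bexI[of _ a] ballI) (simp_all only:)
  qed
  have "S \<noteq> {}"
    using S by auto
  then obtain a where a: "a \<in> S" "\<And>c. c \<in> S \<Longrightarrow> m c \<le> m a"
    using maximizer[OF S(1)] by blast
  have fin: "finite (S - {a})"
    using S(1) by simp
  have "card (S - {a}) \<noteq> 0"
    using S a(1) by simp
  then have "S - {a} \<noteq> {}"
    by force
  then obtain b where b: "b \<in> S - {a}" "\<And>c. c \<in> S - {a} \<Longrightarrow> m c \<le> m b"
    using maximizer[OF fin] by blast
  let ?R = "sorted_list_of_multiset (image_mset m (mset_set (S - {a} - {b})))"
  have "mset_set S = add_mset a (add_mset b (mset_set (S - {a} - {b})))"
    using S(1) a(1) b(1) mset_set.remove by (metis finite_Diff)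
  then have "image_mset m (mset_set S) = mset (?R @ [m b, m a])"
    by simp
  moreover have "sorted (?R @ [m b, m a])"
    using a b fin by (auto simp: sorted_append)
  ultimately have "sorted_list_of_multiset (image_mset m (mset_set S)) = ?R @ [m b, m a]"
    by (metis sorted_list_of_multiset_mset sorted_sort_id)
  then show thesis
    using that[of a b] a b by auto
qed

lemma S2_eigenbasis:
  fixes H :: "complex^'n^'n"
  assumes n: "CARD('n) \<ge> 2" and S: "orthonormal S" "card S = CARD('n)"
    and m: "\<And>u. u \<in> S \<Longrightarrow> H *v u = complex_of_real (m u) *s u"
  obtains a b where "a \<in> S" "b \<in> S" "a \<noteq> b" "m b \<le> m a" "\<And>c. c \<in> S - {a} \<Longrightarrow> m c \<le> m b"
    "S2 H = m a + m b"
proof -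
  have fin: "finite S"
    using S(1) by (rule orthonormal_finite)
  have "charpoly H = (\<Prod>u\<in>S. [:- complex_of_real (m u), 1:])"
    using charpoly_eigenbasis S m by blast
  then have "proots (charpoly H) = (\<Sum>u\<in>S. {#complex_of_real (m u)#})"
    by (simp add: proots_prod)
  also have "\<dots> = image_mset (\<lambda>u. complex_of_real (m u)) (mset_set S)"
    using fin by (induction S rule: finite_induct) auto
  finally have "image_mset Re (proots (charpoly H)) = image_mset m (mset_set S)"
    by (simp add: multiset.map_comp o_def)
  then have "eigenvalues_desc H = rev (sorted_list_of_multiset (image_mset m (mset_set S)))"
    by (simp add: eigenvalues_desc_def)
  moreover obtain a b where "a \<in> S" "b \<in> S" "a \<noteq> b" "m b \<le> m a" "\<And>c. c \<in> S - {a} \<Longrightarrow> m c \<le> m b"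
    "rev (sorted_list_of_multiset (image_mset m (mset_set S))) ! 0 = m a"
    "rev (sorted_list_of_multiset (image_mset m (mset_set S))) ! 1 = m b"
    using two_largest[of S m] fin n S(2) by metis
  ultimately show thesis
    using that[of a b] by (simp add: S2_def)
qed


section \<open>Ky Fan's principle for the two largest eigenvalues\<close>

text \<open>
  In eigencoordinates the quadratic form is a weighted sum of eigenvalues. For \<open>H\<close> the identity
  matrix this is Parseval's identity.
\<close>
lemma eigenbasis_quadratic_form:
  fixes H :: "complex^'n^'n"
  assumes S: "orthonormal S" "card S = CARD('n)"
    and m: "\<And>e. e \<in> S \<Longrightarrow> H *v e = complex_of_real (m e) *s e"
  shows "u \<bullet> (H *v u) = (\<Sum>e\<in>S. m e * (cmod (cinner e u))\<^sup>2)"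
proof -
  have "H *v u = H *v (\<Sum>e\<in>S. cinner e u *s e)"
    using orthonormal_basis_expansion[OF S, of u] by simp
  also have "\<dots> = (\<Sum>e\<in>S. (complex_of_real (m e) * cinner e u) *s e)"
    using m by (simp add: vec.sum vec.scale mult.commute)
  finally have "cinner u (H *v u) = (\<Sum>e\<in>S. complex_of_real (m e) * cinner e u * cinner u e)"
    by (simp add: cinner_sum_right cinner_scale_right)
  also have "\<dots> = (\<Sum>e\<in>S. complex_of_real (m e * (cmod (cinner e u))\<^sup>2))"
    by (intro sum.cong refl) (metis cinner_cnj complex_norm_square mult.assoc of_real_mult)
  also have "\<dots> = complex_of_real (\<Sum>e\<in>S. m e * (cmod (cinner e u))\<^sup>2)"
    by simp
  finally show ?thesis
    by (metis Re_cinner Re_complex_of_real)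
qed

text \<open>
  The left side is \<open>\<Sum> m\<^sub>e w\<^sub>e\<close>, where \<open>w\<^sub>e\<close> is the squared length of the projection of the basis vector
  \<open>e\<close> to the plane of \<open>u\<close> and \<open>v\<close>. Bessel's inequality gives \<open>0 \<le> w\<^sub>e \<le> 1\<close> and Parseval's
  identity gives \<open>\<Sum> w\<^sub>e = 2\<close>; under these constraints the sum is largest when all the weight sits on
  the two largest eigenvalues.
\<close>
lemma orthonormal_pair_le_S2:
  fixes H :: "complex^'n^'n"
  assumes n: "CARD('n) \<ge> 2" and H: "conj_transpose H = H"
    and uv: "orthonormal {u, v}" "u \<noteq> v"
  shows "u \<bullet> (H *v u) + v \<bullet> (H *v v) \<le> S2 H"
proof -
  obtain S m where S: "orthonormal S" "card S = CARD('n)"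
    and m: "\<And>e. e \<in> S \<Longrightarrow> H *v e = complex_of_real (m e) *s e"
    using hermitian_orthonormal_eigenbasis[OF H] by blast
  obtain a b where ab: "a \<in> S" "m b \<le> m a" "\<And>c. c \<in> S - {a} \<Longrightarrow> m c \<le> m b" "S2 H = m a + m b"
    using S2_eigenbasis[OF n S m] by metis
  define w where "w e = (cmod (cinner e u))\<^sup>2 + (cmod (cinner e v))\<^sup>2" for e
  have fin: "finite S"
    using S(1) by (rule orthonormal_finite)
  have w_nonneg: "0 \<le> w e" for e
    by (simp add: w_def)
  have w_le_1: "w e \<le> 1" if "e \<in> S" for e
  proof -
    have "cmod (cinner x e) = cmod (cinner e x)" for x
      by (metis cinner_cnj complex_mod_cnj)
    then have "w e \<le> (norm e)\<^sup>2"
      using bessel_inequality[OF uv(1), of e] uv(2) by (simp add: w_def)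
    then show ?thesis
      using orthonormal_norm[OF S(1) that] by simp
  qed
  have parseval: "(\<Sum>e\<in>S. (cmod (cinner e x))\<^sup>2) = (norm x)\<^sup>2" for x
    using eigenbasis_quadratic_form[OF S, of "mat 1" "\<lambda>_. 1" x]
    by (simp add: power2_norm_eq_inner)
  have w_sum: "(\<Sum>e\<in>S. w e) = 2"
    using orthonormal_norm[OF uv(1)] by (simp add: w_def sum.distrib parseval)
  have "u \<bullet> (H *v u) + v \<bullet> (H *v v) = (\<Sum>e\<in>S. m e * w e)"
    by (simp add: eigenbasis_quadratic_form[OF S m] w_def sum.distrib algebra_simps)
  \<comment> \<open>Subtracting the second largest eigenvalue leaves only the largest one with a possibly
    positive coefficient.\<close>
  also have "\<dots> = (\<Sum>e\<in>S. (m e - m b) * w e) + m b * (\<Sum>e\<in>S. w e)"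
    by (simp add: algebra_simps sum_subtractf sum_distrib_left)
  also have "(\<Sum>e\<in>S. (m e - m b) * w e) \<le> (\<Sum>e\<in>S. if e = a then m a - m b else 0)"
  proof (rule sum_mono)
    fix e assume e: "e \<in> S"
    show "(m e - m b) * w e \<le> (if e = a then m a - m b else 0)"
      using ab e w_nonneg[of e] w_le_1[OF e]
      by (auto simp: mult_left_le mult_nonpos_nonneg)
  qed
  finally show ?thesis
    using ab fin w_sum by simp
qed

lemma S2_attained:
  fixes H :: "complex^'n^'n"
  assumes n: "CARD('n) \<ge> 2" and H: "conj_transpose H = H"
  obtains u v where "orthonormal {u, v}" "u \<noteq> v" "u \<bullet> (H *v u) + v \<bullet> (H *v v) = S2 H"
proof -
  obtain S m where S: "orthonormal S" "card S = CARD('n)"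
    and m: "\<And>e. e \<in> S \<Longrightarrow> H *v e = complex_of_real (m e) *s e"
    using hermitian_orthonormal_eigenbasis[OF H] by blast
  obtain a b where ab: "a \<in> S" "b \<in> S" "a \<noteq> b" "S2 H = m a + m b"
    using S2_eigenbasis[OF n S m] by metis
  have "e \<bullet> (H *v e) = m e" if "e \<in> S" for e
    using orthonormal_norm[OF S(1) that]
    by (simp add: m[OF that] flip: scaleR_eq_scale power2_norm_eq_inner)
  then show thesis
    using that[of a b] ab S(1) by (auto simp: orthonormal_def)
qed

text \<open>
  Evaluate the combination on an orthonormal pair that attains its \<^const>\<open>S2\<close>; on that pair the
  quadratic forms of \<open>A\<close> and \<open>B\<close> stay below their own maxima.
\<close>
lemma S2_sublinear:
  fixes A B :: "complex^'n^'n"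
  assumes n: "CARD('n) \<ge> 2" and A: "conj_transpose A = A" and B: "conj_transpose B = B"
    and nonneg: "\<alpha> \<ge> 0" "\<beta> \<ge> 0"
  shows "S2 (\<alpha> *\<^sub>R A + \<beta> *\<^sub>R B) \<le> \<alpha> * S2 A + \<beta> * S2 B"
proof -
  let ?H = "\<alpha> *\<^sub>R A + \<beta> *\<^sub>R B"
  have "conj_transpose ?H = ?H"
    using A B by (simp add: vec_eq_iff conj_transpose_def)
  then obtain u v where uv: "orthonormal {u, v}" "u \<noteq> v"
    and S2: "u \<bullet> (?H *v u) + v \<bullet> (?H *v v) = S2 ?H"
    using S2_attained[OF n] by blast
  have H_apply: "?H *v x = \<alpha> *\<^sub>R (A *v x) + \<beta> *\<^sub>R (B *v x)" for x
    by (simp add: matrix_vector_mult_add_rdistrib vec_eq_iff matrix_vector_mult_def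
        scaleR_sum_right sum.distrib distrib_right)
  have "S2 ?H = \<alpha> * (u \<bullet> (A *v u) + v \<bullet> (A *v v)) + \<beta> * (u \<bullet> (B *v u) + v \<bullet> (B *v v))"
    unfolding S2[symmetric] H_apply by (simp add: inner_simps algebra_simps)
  also have "\<dots> \<le> \<alpha> * S2 A + \<beta> * S2 B"
    using orthonormal_pair_le_S2[OF n A uv] orthonormal_pair_le_S2[OF n B uv] nonneg
    by (intro add_mono mult_left_mono)
  finally show ?thesis .
qed


section \<open>Generalized Jacobians of combined systems\<close>

lemma hermitian_part_hermitian: "conj_transpose (hermitian_part F) = hermitian_part F"
  by (simp add: hermitian_part_def conj_transpose_def vec_eq_iff add.commute)

lemma hermitian_part_combination:
  "hermitian_part (\<alpha> *\<^sub>R F + \<beta> *\<^sub>R G) = \<alpha> *\<^sub>R hermitian_part F + \<beta> *\<^sub>R hermitian_part G"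
  by (simp add: hermitian_part_def conj_transpose_def vec_eq_iff algebra_simps)

lemma jacobian_combination:
  fixes f g :: "real^'n \<Rightarrow> real^'n"
  assumes "f differentiable (at x)" "g differentiable (at x)"
  shows "jacobian (\<lambda>x. \<alpha> *\<^sub>R f x + \<beta> *\<^sub>R g x) (at x)
    = \<alpha> *\<^sub>R jacobian f (at x) + \<beta> *\<^sub>R jacobian g (at x)"
proof -
  have "((\<lambda>x. \<alpha> *\<^sub>R f x + \<beta> *\<^sub>R g x) has_derivative
      (\<lambda>h. \<alpha> *\<^sub>R frechet_derivative f (at x) h + \<beta> *\<^sub>R frechet_derivative g (at x) h)) (at x)"
    using assms by (intro derivative_intros) (simp_all add: frechet_derivative_works)
  from frechet_derivative_at[OF this, symmetric] show ?thesis
    by (simp add: jacobian_def matrix_def vec_eq_iff)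
qed

text \<open>
  The direction \<open>(0, 1)\<close> is the space-time direction of the vector field \<open>0\<close>, whose trajectory rests
  at \<open>x\<close>.
\<close>
lemma time_derivative_zero_if_constant:
  fixes \<Theta> :: "(real^'n) \<times> real \<Rightarrow> complex^'n^'n"
  assumes d: "\<Theta> differentiable (at (x, t))" and const: "\<And>s. \<Theta> (x, s) = \<Theta> (x, t)"
  shows "frechet_derivative \<Theta> (at (x, t)) (0, 1) = 0"
proof -
  have "((\<lambda>s. \<Theta> (x, s)) has_vector_derivative trajectory_deriv \<Theta> (\<lambda>_. 0) x t) (at t)"
    using trajectory_deriv_along_trajectory[of \<Theta> "\<lambda>_. x" t "\<lambda>_. 0" UNIV] d by simp
  moreover have "((\<lambda>s. \<Theta> (x, s)) has_vector_derivative 0) (at t)"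
    by (subst const) (rule has_vector_derivative_const)
  ultimately show ?thesis
    unfolding trajectory_deriv_def by (rule vector_derivative_unique_at)
qed

text \<open>
  The time components do not combine linearly: \<open>(\<alpha> f + \<beta> g, 1)\<close> exceeds \<open>\<alpha> (f, 1) + \<beta> (g, 1)\<close> by
  \<open>1 - (\<alpha> + \<beta>)\<close> in the time direction. Either that factor or the explicit time derivative is zero.
\<close>
lemma trajectory_deriv_combination:
  assumes d: "\<Theta> differentiable (at (x, t))"
    and time: "(\<forall>s. \<Theta> (x, s) = \<Theta> (x, t)) \<or> \<alpha> + \<beta> = 1"
  shows "trajectory_deriv \<Theta> (\<lambda>x. \<alpha> *\<^sub>R f x + \<beta> *\<^sub>R g x) x t
    = \<alpha> *\<^sub>R trajectory_deriv \<Theta> f x t + \<beta> *\<^sub>R trajectory_deriv \<Theta> g x t"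
proof -
  let ?D = "frechet_derivative \<Theta> (at (x, t))"
  have lin: "linear ?D"
    using d by (rule linear_frechet_derivative)
  have "(\<alpha> *\<^sub>R f x + \<beta> *\<^sub>R g x, 1 :: real) = \<alpha> *\<^sub>R (f x, 1) + \<beta> *\<^sub>R (g x, 1) + (1 - (\<alpha> + \<beta>)) *\<^sub>R (0, 1)"
    by simp
  then have "?D (\<alpha> *\<^sub>R f x + \<beta> *\<^sub>R g x, 1)
      = \<alpha> *\<^sub>R ?D (f x, 1) + \<beta> *\<^sub>R ?D (g x, 1) + (1 - (\<alpha> + \<beta>)) *\<^sub>R ?D (0, 1)"
    by (simp only: linear_add[OF lin] linear_scale[OF lin])
  moreover have "(1 - (\<alpha> + \<beta>)) *\<^sub>R ?D (0, 1) = 0"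
    using time time_derivative_zero_if_constant[OF d] by auto
  ultimately show ?thesis
    by (simp add: trajectory_deriv_def)
qed

lemma generalized_jacobian_combination:
  fixes f g :: "real^'n \<Rightarrow> real^'n"
  assumes "f differentiable (at x)" "g differentiable (at x)" "\<Theta> differentiable (at (x, t))"
    and "(\<forall>s. \<Theta> (x, s) = \<Theta> (x, t)) \<or> \<alpha> + \<beta> = 1"
  shows "generalized_jacobian \<Theta> (\<lambda>x. \<alpha> *\<^sub>R f x + \<beta> *\<^sub>R g x) x t
    = \<alpha> *\<^sub>R generalized_jacobian \<Theta> f x t + \<beta> *\<^sub>R generalized_jacobian \<Theta> g x t"
proof -
  have "map_matrix complex_of_real (\<alpha> *\<^sub>R J + \<beta> *\<^sub>R K)
      = \<alpha> *\<^sub>R map_matrix complex_of_real J + \<beta> *\<^sub>R map_matrix complex_of_real K"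
    for J K :: "real^'n^'n"
    by (simp add: vec_eq_iff scaleR_conv_of_real[where 'a = complex])
  moreover have "(c *\<^sub>R M) ** N = c *\<^sub>R (M ** N)" "M ** (c *\<^sub>R N) = c *\<^sub>R (M ** N)"
    for c and M N :: "complex^'n^'n"
    by (simp_all add: vec_eq_iff matrix_matrix_mult_def scaleR_sum_right)
  moreover have "(L + M) ** N = L ** N + M ** N" for L M N :: "complex^'n^'n"
    by (simp add: vec_eq_iff matrix_matrix_mult_def distrib_right sum.distrib)
  ultimately show ?thesis
    unfolding generalized_jacobian_def jacobian_combination[OF assms(1,2)]
      trajectory_deriv_combination[OF assms(3,4)]
    by (simp add: matrix_add_ldistrib scaleR_add_right)
qed

theorem theorem1:
  fixes X :: "(real^'n) set"
    and fa fb :: "real^'n \<Rightarrow> real^'n"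
    and \<Theta> :: "(real^'n) \<times> real \<Rightarrow> complex^'n^'n"
    and \<alpha> \<beta> :: real
  assumes "CARD('n) \<ge> 2"
    and "compact X" and "simply_connected X"
    and "\<forall>x\<in>X. fa differentiable (at x)" and "\<forall>x\<in>X. fb differentiable (at x)"
    and "strictly_forward_invariant X fa" and "strictly_forward_invariant X fb"
    and "metric_transformation X \<Theta>"
    and "weakly_contracting X \<Theta> fa" and "weakly_contracting X \<Theta> fb"
    and "\<alpha> \<ge> 0" and "\<beta> \<ge> 0" and "\<alpha> + \<beta> > 0"
    and "forward_invariant X (\<lambda>x. \<alpha> *\<^sub>R fa x + \<beta> *\<^sub>R fb x)"
    \<comment> \<open>without this the claim fails: an explicit time derivative of \<open>\<Theta>\<close> does not scale with \<open>\<alpha>\<close>, \<open>\<beta>\<close>\<close>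
    and "(\<forall>x\<in>X. \<forall>s t. \<Theta> (x, s) = \<Theta> (x, t)) \<or> \<alpha> + \<beta> = 1"
  shows "weakly_contracting X \<Theta> (\<lambda>x. \<alpha> *\<^sub>R fa x + \<beta> *\<^sub>R fb x)"
  unfolding weakly_contracting_def
proof (intro ballI allI)
  fix x t
  assume x: "x \<in> X"
  let ?F = "\<lambda>f. generalized_jacobian \<Theta> f x t"
  have "?F (\<lambda>x. \<alpha> *\<^sub>R fa x + \<beta> *\<^sub>R fb x) = \<alpha> *\<^sub>R ?F fa + \<beta> *\<^sub>R ?F fb"
    using assms x by (intro generalized_jacobian_combination) (auto simp: metric_transformation_def)
  then have "S2 (hermitian_part (?F (\<lambda>x. \<alpha> *\<^sub>R fa x + \<beta> *\<^sub>R fb x)))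
      \<le> \<alpha> * S2 (hermitian_part (?F fa)) + \<beta> * S2 (hermitian_part (?F fb))"
    using assms(1,11,12) by (simp add: hermitian_part_combination S2_sublinear hermitian_part_hermitian)
  also have "\<dots> < 0"
  proof -
    have neg: "S2 (hermitian_part (?F fa)) < 0" "S2 (hermitian_part (?F fb)) < 0"
      using assms(9,10) x by (auto simp: weakly_contracting_def)
    have "\<alpha> * S2 (hermitian_part (?F fa)) \<le> 0" "\<beta> * S2 (hermitian_part (?F fb)) \<le> 0"
      using neg assms(11,12) by (simp_all add: mult_nonneg_nonpos)
    moreover have "\<alpha> * S2 (hermitian_part (?F fa)) < 0 \<or> \<beta> * S2 (hermitian_part (?F fb)) < 0"
      using neg assms(13) mult_pos_neg[of \<alpha>] mult_pos_neg[of \<beta>] by (cases "\<alpha> > 0") auto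
    ultimately show ?thesis
      by linarith
  qed
  finally show "S2 (hermitian_part (?F (\<lambda>x. \<alpha> *\<^sub>R fa x + \<beta> *\<^sub>R fb x))) < 0" .
qed

end
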